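(* Let $X$ and $Y$ be nontrivial (i.e. nonzero) Banach spaces. Then $X\oplus_1 Y$ is not almost square (ASQ).
   Context: All Banach spaces are real. $S_X$ and $B_X$ denote the unit sphere and closed unit ball of $X$. A Banach space $X$ is almost square (ASQ) if for every finite subset $(x_i)_{i=1}^N \subset S_X$ there exists a sequence $(y_n)\subset B_X$ such that $\|x_i\pm y_n\|\to 1$ for every $i=1,\ldots,N$ and $\|y_n\|\to 1$. $X\oplus_1 Y$ is the direct sum with norm $\|(x,y)\|=\|x\|+\|y\|$. *)

theory Defs
  imports "HOL-Analysis.Analysis"
begin

text \<open>The product type already carries the Euclidean norm, so the direct sum with
  norm \<open>\<parallel>(x, y)\<parallel> = \<parallel>x\<parallel> + \<parallel>y\<parallel>\<close> is a separate copy of it.\<close>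

datatype ('a, 'b) l1_sum = L1_Pair (l1_fst: 'a) (l1_snd: 'b)

instantiation l1_sum :: (real_vector, real_vector) real_vector
begin

definition zero_l1_sum :: "('a, 'b) l1_sum" where
  "0 = L1_Pair 0 0"

definition plus_l1_sum :: "('a, 'b) l1_sum \<Rightarrow> ('a, 'b) l1_sum \<Rightarrow> ('a, 'b) l1_sum" where
  "u + v = L1_Pair (l1_fst u + l1_fst v) (l1_snd u + l1_snd v)"

definition minus_l1_sum :: "('a, 'b) l1_sum \<Rightarrow> ('a, 'b) l1_sum \<Rightarrow> ('a, 'b) l1_sum" where
  "u - v = L1_Pair (l1_fst u - l1_fst v) (l1_snd u - l1_snd v)"

definition uminus_l1_sum :: "('a, 'b) l1_sum \<Rightarrow> ('a, 'b) l1_sum" where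
  "- u = L1_Pair (- l1_fst u) (- l1_snd u)"

definition scaleR_l1_sum :: "real \<Rightarrow> ('a, 'b) l1_sum \<Rightarrow> ('a, 'b) l1_sum" where
  "r *\<^sub>R u = L1_Pair (r *\<^sub>R l1_fst u) (r *\<^sub>R l1_snd u)"

instance
proof
  fix r s :: real and u v w :: "('a, 'b) l1_sum"
  note ops = zero_l1_sum_def plus_l1_sum_def minus_l1_sum_def uminus_l1_sum_def scaleR_l1_sum_def
  show "u + v + w = u + (v + w)" "u + v = v + u" "0 + u = u" "- u + u = 0" "u - v = u + - v"
    "r *\<^sub>R (u + v) = r *\<^sub>R u + r *\<^sub>R v" "(r + s) *\<^sub>R u = r *\<^sub>R u + s *\<^sub>R u"
    "r *\<^sub>R s *\<^sub>R u = (r * s) *\<^sub>R u" "1 *\<^sub>R u = u"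
    by (simp_all add: ops algebra_simps)
qed

end

instantiation l1_sum :: (real_normed_vector, real_normed_vector) real_normed_vector
begin

definition norm_l1_sum :: "('a, 'b) l1_sum \<Rightarrow> real" where
  "norm u = norm (l1_fst u) + norm (l1_snd u)"

definition sgn_l1_sum :: "('a, 'b) l1_sum \<Rightarrow> ('a, 'b) l1_sum" where
  "sgn (u :: ('a, 'b) l1_sum) = u /\<^sub>R norm u"

definition dist_l1_sum :: "('a, 'b) l1_sum \<Rightarrow> ('a, 'b) l1_sum \<Rightarrow> real" where
  "dist (u :: ('a, 'b) l1_sum) v = norm (u - v)"

definition uniformity_l1_sum :: "(('a, 'b) l1_sum \<times> ('a, 'b) l1_sum) filter" where
  "uniformity = (INF e\<in>{0<..}. principal {(u :: ('a, 'b) l1_sum, v). dist u v < e})"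

definition open_l1_sum :: "('a, 'b) l1_sum set \<Rightarrow> bool" where
  "open (U :: ('a, 'b) l1_sum set) \<longleftrightarrow> (\<forall>u\<in>U. eventually (\<lambda>(u', v). u' = u \<longrightarrow> v \<in> U) uniformity)"

instance
proof
  fix r :: real and u v :: "('a, 'b) l1_sum" and U :: "('a, 'b) l1_sum set"
  show "dist (u :: ('a, 'b) l1_sum) v = norm (u - v)"
    by (rule dist_l1_sum_def)
  show "sgn (u :: ('a, 'b) l1_sum) = u /\<^sub>R norm u"
    by (rule sgn_l1_sum_def)
  show "uniformity = (INF e\<in>{0<..}. principal {(u :: ('a, 'b) l1_sum, v). dist u v < e})"
    by (rule uniformity_l1_sum_def)
  show "open (U :: ('a, 'b) l1_sum set) \<longleftrightarrow> (\<forall>u\<in>U. eventually (\<lambda>(u', v). u' = u \<longrightarrow> v \<in> U) uniformity)"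
    by (rule open_l1_sum_def)
  show "norm u = 0 \<longleftrightarrow> u = 0"
    by (cases u) (simp add: norm_l1_sum_def zero_l1_sum_def add_nonneg_eq_0_iff)
  show "norm (u + v) \<le> norm u + norm v"
    using norm_triangle_ineq[of "l1_fst u" "l1_fst v"] norm_triangle_ineq[of "l1_snd u" "l1_snd v"]
    by (simp add: norm_l1_sum_def plus_l1_sum_def)
  show "norm (r *\<^sub>R u) = \<bar>r\<bar> * norm u"
    by (simp add: norm_l1_sum_def scaleR_l1_sum_def distrib_left)
qed

end

instance l1_sum :: (banach, banach) banach
proof
  fix X :: "nat \<Rightarrow> ('a, 'b) l1_sum"
  assume X: "Cauchy X"
  have d: "dist u v = dist (l1_fst u) (l1_fst v) + dist (l1_snd u) (l1_snd v)"
    for u v :: "('a, 'b) l1_sum"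
    by (simp add: dist_norm norm_l1_sum_def minus_l1_sum_def)
  have le: "dist (l1_fst u) (l1_fst v) \<le> dist u v" "dist (l1_snd u) (l1_snd v) \<le> dist u v"
    for u v :: "('a, 'b) l1_sum"
    by (simp_all add: d)
  have "Cauchy (\<lambda>n. l1_fst (X n))" "Cauchy (\<lambda>n. l1_snd (X n))"
    using X unfolding Cauchy_def by (meson le le_less_trans)+
  then obtain a b where "(\<lambda>n. l1_fst (X n)) \<longlonglongrightarrow> a" "(\<lambda>n. l1_snd (X n)) \<longlonglongrightarrow> b"
    by (meson Cauchy_convergent convergent_def)
  then have "(\<lambda>n. dist (l1_fst (X n)) a + dist (l1_snd (X n)) b) \<longlonglongrightarrow> 0 + 0"
    by (intro tendsto_add) (simp_all only: tendsto_dist_iff[symmetric])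
  then have "X \<longlonglongrightarrow> L1_Pair a b"
    by (subst tendsto_dist_iff) (simp add: d)
  then show "convergent X"
    by (rule convergentI)
qed

definition almost_square :: "'a::banach itself \<Rightarrow> bool" where
  "almost_square TYPE('a) \<longleftrightarrow>
    (\<forall>S::'a set. finite S \<and> S \<subseteq> sphere 0 1 \<longrightarrow>
      (\<exists>y. (\<forall>n::nat. y n \<in> cball 0 1) \<and>
        (\<forall>x\<in>S. (\<lambda>n. norm (x + y n)) \<longlonglongrightarrow> 1 \<and> (\<lambda>n. norm (x - y n)) \<longlonglongrightarrow> 1) \<and>
        (\<lambda>n. norm (y n)) \<longlonglongrightarrow> 1))"

end

theory Submission imports Defs begin

text \<open>Fix unit vectors \<open>x\<close> and \<open>z\<close> of the two summands and put \<open>p = (x, 0)\<close>, \<open>q = (0, z)\<close>.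
  For \<open>y = (a, b)\<close>, convexity of the norm gives
  \<open>\<parallel>p + y\<parallel> + \<parallel>p - y\<parallel> \<ge> 2 + 2\<parallel>b\<parallel>\<close> and \<open>\<parallel>q + y\<parallel> + \<parallel>q - y\<parallel> \<ge> 2 + 2\<parallel>a\<parallel>\<close>, so the four
  norms add up to at least \<open>4 + 2\<parallel>y\<parallel>\<close>. Along a sequence witnessing almost squareness for \<open>{p, q}\<close>
  this would become \<open>4 \<ge> 6\<close> in the limit.\<close>

text \<open>Triangle inequality for the sum \<open>(x + a) + (x - a)\<close>, which is twice
  \<open>x\<close>.\<close>

lemma norm_add_add_norm_diff_ge:
  fixes x a :: "'a::real_normed_vector"
  shows "2 * norm x \<le> norm (x + a) + norm (x - a)"
  using norm_triangle_ineq[of "x + a" "x - a"]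
  by (simp add: scaleR_2[symmetric])

text \<open>The zero coordinate of \<open>p\<close> leaves \<open>norm (l1_snd y)\<close> in both
  \<open>p + y\<close> and \<open>p - y\<close>; that of \<open>q\<close> leaves
  \<open>norm (l1_fst y)\<close> twice. Together they supply \<open>2 * norm y\<close>.\<close>

lemma norm_axes_ge:
  fixes x :: "'a::real_normed_vector" and z :: "'b::real_normed_vector"
    and y :: "('a, 'b) l1_sum"
  defines "p \<equiv> L1_Pair x 0" and "q \<equiv> L1_Pair 0 z"
  shows "2 * norm x + 2 * norm z + 2 * norm y
    \<le> (norm (p + y) + norm (p - y)) + (norm (q + y) + norm (q - y))"
  using norm_add_add_norm_diff_ge[of x "l1_fst y"] norm_add_add_norm_diff_ge[of z "l1_snd y"]
  by (simp add: p_def q_def norm_l1_sum_def plus_l1_sum_def minus_l1_sum_def)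

theorem lemma5p5:
  assumes "\<exists>x::'a::banach. x \<noteq> 0"
    and "\<exists>y::'b::banach. y \<noteq> 0"
  shows "\<not> almost_square TYPE(('a, 'b) l1_sum)"
proof
  assume asq: "almost_square TYPE(('a, 'b) l1_sum)"
  obtain u :: 'a and v :: 'b where "u \<noteq> 0" and "v \<noteq> 0"
    using assms by blast
  then obtain x :: 'a and z :: 'b where x: "norm x = 1" and z: "norm z = 1"
    using that[of "sgn u" "sgn v"] by (simp add: norm_sgn)
  define p q :: "('a, 'b) l1_sum" where "p = L1_Pair x 0" and "q = L1_Pair 0 z"
  have "finite {p, q} \<and> {p, q} \<subseteq> sphere 0 1"
    by (simp add: p_def q_def norm_l1_sum_def x z)
  then obtain y where
    y: "\<forall>w\<in>{p, q}. (\<lambda>n. norm (w + y n)) \<longlonglongrightarrow> 1 \<and> (\<lambda>n. norm (w - y n)) \<longlonglongrightarrow> 1"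
    and y1: "(\<lambda>n::nat. norm (y n)) \<longlonglongrightarrow> 1"
    using asq unfolding almost_square_def by meson
  \<comment> \<open>The 4 is \<open>2 * norm x + 2 * norm z\<close> for the unit vectors
    \<open>x\<close> and \<open>z\<close>.\<close>
  have lower: "(\<lambda>n. 4 + 2 * norm (y n)) \<longlonglongrightarrow> 4 + 2 * 1"
    using y1 by (intro tendsto_intros)
  have upper: "(\<lambda>n. (norm (p + y n) + norm (p - y n)) + (norm (q + y n) + norm (q - y n)))
      \<longlonglongrightarrow> (1 + 1) + (1 + 1)"
    using y by (intro tendsto_add) auto
  have "4 + 2 * norm (y n)
      \<le> (norm (p + y n) + norm (p - y n)) + (norm (q + y n) + norm (q - y n))" for n
    using norm_axes_ge[of x z "y n"] by (simp add: p_def q_def x z)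
  then have "(4::real) + 2 * 1 \<le> (1 + 1) + (1 + 1)"
    by (intro LIMSEQ_le[OF lower upper]) blast
  then show False
    by simp
qed

end
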